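(* Let $X_1,X_2,\ldots$ be (possibly dependent) random variables with common continuous distribution function $F$ and let $M_n=\max(X_1,\dots,X_n)$. Suppose that the diagonal $\delta_n$ of the copula $C_n$ of $(X_1,\dots,X_n)$ is strictly increasing for each $n$ and that there exist a function $r:\mathbb{N}\to(0,\infty)$ and a bijection $\lambda:(0,\infty)\to(0,\infty)$ such that the following conditions hold: (i) $\lim_{n\to\infty}r_n=\infty$ and $\lim_{n\to\infty}r_{\lceil tn\rceil}/r_n=\lambda(t)$ for all $t>0$; (ii) the diagonal power distortion $D_n^r$ with respect to $r$ converges pointwise to a continuous and strictly increasing bijection $D:[0,1]\to[0,1]$. If there exist sequences $(c_n)$, $c_n>0$, and $(d_n)$ of real numbers such that $(M_n-d_n)/c_n$ converges in distribution to a nondegenerate distribution function $G$, then $G=D\circ H$ where $H$ is a generalized extreme value distribution function.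
   Context: Since $F$ is continuous, for each $n$ there is a unique copula $C_n$ (a distribution function on $[0,1]^n$ with standard uniform univariate margins) with $\mathbb{P}(X_1\le x_1,\dots,X_n\le x_n)=C_n(F(x_1),\dots,F(x_n))$. Its diagonal is $\delta_n(u)=C_n(u,\dots,u)$, $u\in[0,1]$. For a rate $r:\mathbb{N}\to(0,\infty)$ (write $r_n=r(n)$), the diagonal power distortion is $D_n^r:[0,1]\to[0,1]$, $D_n^r(u)=\delta_n(u^{1/r_n})$. $\lceil\cdot\rceil$ is the ceiling function. Generalized extreme value (GEV) distribution functions are $H_{\xi,\mu,\sigma}$ with $\xi,\mu\in\mathbb{R}$, $\sigma>0$: $H_{\xi,\mu,\sigma}(x)=\exp(-(1+\xi(x-\mu)/\sigma)^{-1/\xi})$ if $\xi\ne0$ and $\exp(-e^{-(x-\mu)/\sigma})$ if $\xi=0$, for all $x$ with $1+\xi(x-\mu)/\sigma>0$, and the corresponding limiting value $0$ or $1$ otherwise. *)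

theory Defs
  imports "HOL-Probability.Probability"
begin

text \<open>
  Indices run over \<open>1, 2, \<dots>\<close>.  A point of \<open>n\<close>-dimensional space is a function on \<open>{1..n}\<close>,
  extended by \<open>undefined\<close> (the carrier of \<open>Pi\<^sub>M {1..n} (\<lambda>_. borel)\<close>).
\<close>

definition multivariate_cdf :: "nat \<Rightarrow> (nat \<Rightarrow> real) measure \<Rightarrow> (nat \<Rightarrow> real) \<Rightarrow> real" where
  "multivariate_cdf n P u = measure P {x \<in> space P. \<forall>i\<in>{1..n}. x i \<le> u i}"

text \<open>Only the values of \<open>C\<close> on the cube \<open>[0,1]\<^sup>n\<close> are constrained.\<close>

definition copula :: "nat \<Rightarrow> ((nat \<Rightarrow> real) \<Rightarrow> real) \<Rightarrow> bool" where
  "copula n C \<longleftrightarrow>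
     (\<exists>P. prob_space P \<and> sets P = sets (Pi\<^sub>M {1..n} (\<lambda>_. borel)) \<and>
          (\<forall>i\<in>{1..n}. distr P borel (\<lambda>x. x i) = uniform_measure lborel {0..1}) \<and>
          (\<forall>u \<in> {1..n} \<rightarrow>\<^sub>E {0..1}. C u = multivariate_cdf n P u))"

definition copula_of ::
  "'a measure \<Rightarrow> (nat \<Rightarrow> 'a \<Rightarrow> real) \<Rightarrow> (real \<Rightarrow> real) \<Rightarrow> nat \<Rightarrow> ((nat \<Rightarrow> real) \<Rightarrow> real) \<Rightarrow> bool" where
  "copula_of M X F n C \<longleftrightarrow>
     copula n C \<and>
     (\<forall>x :: nat \<Rightarrow> real.
        measure M {\<omega> \<in> space M. \<forall>i\<in>{1..n}. X i \<omega> \<le> x i} = C (\<lambda>i\<in>{1..n}. F (x i)))"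

definition diagonal :: "nat \<Rightarrow> ((nat \<Rightarrow> real) \<Rightarrow> real) \<Rightarrow> real \<Rightarrow> real" where
  "diagonal n C u = C (\<lambda>i\<in>{1..n}. u)"

definition diagonal_power_distortion ::
  "(nat \<Rightarrow> (nat \<Rightarrow> real) \<Rightarrow> real) \<Rightarrow> (nat \<Rightarrow> real) \<Rightarrow> nat \<Rightarrow> real \<Rightarrow> real" where
  "diagonal_power_distortion C r n u = diagonal n (C n) (u powr (1 / r n))"

definition partial_max :: "(nat \<Rightarrow> 'a \<Rightarrow> real) \<Rightarrow> nat \<Rightarrow> 'a \<Rightarrow> real" where
  "partial_max X n \<omega> = Max ((\<lambda>i. X i \<omega>) ` {1..n})"

definition distribution_function :: "(real \<Rightarrow> real) \<Rightarrow> bool" where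
  "distribution_function G \<longleftrightarrow> (\<exists>N. real_distribution N \<and> G = cdf N)"

text \<open>A distribution function is degenerate if it is that of a point mass.\<close>

definition nondegenerate :: "(real \<Rightarrow> real) \<Rightarrow> bool" where
  "nondegenerate G \<longleftrightarrow> \<not> (\<exists>a. G = indicator {a..})"

definition gev :: "real \<Rightarrow> real \<Rightarrow> real \<Rightarrow> real \<Rightarrow> real" where
  "gev \<xi> \<mu> \<sigma> x =
     (if \<xi> = 0 then exp (- exp (- (x - \<mu>) / \<sigma>))
      else if 1 + \<xi> * (x - \<mu>) / \<sigma> > 0 then exp (- ((1 + \<xi> * (x - \<mu>) / \<sigma>) powr (- 1 / \<xi>)))
      else if \<xi> > 0 then 0 else 1)"

end

theory Submission
  imports Defs
begin

text \<open>
  Let \<open>\<Lambda>\<close> denote \<open>gumbel\<close> and let \<open>W\<close> and \<open>U\<close> be the generalized inverses of \<open>F\<close> and \<open>G\<close>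
  composed with \<open>\<Lambda>\<close> and \<open>D \<circ> \<Lambda>\<close>.  Since \<open>\<Lambda> y powr (1 / r\<^sub>n) = \<Lambda> (y + ln r\<^sub>n)\<close>,
  the limit law for the maxima says that \<open>(W (y + ln r\<^sub>n) - d\<^sub>n) / c\<^sub>n\<close> tends to \<open>U y\<close> at
  continuity points of \<open>U\<close>.  Passing to the indices \<open>\<lceil>t n\<rceil>\<close> shifts the argument by \<open>ln (lam t)\<close>
  in the limit, and the convergence of types yields \<open>U (y + h) = A h * U y + B h\<close> for all
  \<open>h\<close>, because \<open>lam\<close> is onto.  The only nonconstant monotone solutions are affine functions of
  \<open>y\<close> or of \<open>exp (\<xi> * y)\<close>, which are the inverses of the generalized extreme value distribution
  functions composed with \<open>\<Lambda>\<close>.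
\<close>

section \<open>The Gumbel scale for probability levels\<close>

definition gumbel :: "real \<Rightarrow> real" where
  "gumbel y = exp (- exp (- y))"

lemma gumbel_bounds: "0 < gumbel y" "gumbel y < 1"
  by (simp_all add: gumbel_def)

lemma gumbel_le_iff [simp]: "gumbel x \<le> gumbel y \<longleftrightarrow> x \<le> y"
  by (simp add: gumbel_def)

lemma gumbel_surj:
  assumes "0 < p" "p < 1"
  obtains y where "p = gumbel y"
proof
  have "0 < - ln p" using assms by (simp add: ln_less_zero)
  then show "p = gumbel (- ln (- ln p))" using assms by (simp add: gumbel_def)
qed

lemma gumbel_powr_inverse:
  assumes "0 < r"
  shows "gumbel y powr (1 / r) = gumbel (y + ln r)"
proof -
  have "exp (- (y + ln r)) = exp (- y) / r"
    using assms exp_diff[of "- y" "ln r"] by simp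
  then show ?thesis by (simp add: gumbel_def powr_def)
qed

text \<open>The values of \<open>gumbel\<close> fill the open unit interval, so one of them
  separates any two distinct points of \<open>{0..1}\<close>. This turns equality of quantiles into
  equality of distribution functions.\<close>

lemma eq_if_same_gumbel_below:
  assumes "a \<in> {0..1}" "b \<in> {0..1}" "\<And>y. gumbel y \<le> a \<longleftrightarrow> gumbel y \<le> b"
  shows "a = b"
proof -
  have aux: "\<not> a < b" if "a \<in> {0..1}" "b \<in> {0..1}" "\<And>y. gumbel y \<le> a \<longleftrightarrow> gumbel y \<le> b" for a b :: real
  proof
    assume "a < b"
    then obtain p where p: "a < p" "p < b" using dense by blast
    with that obtain y where "p = gumbel y" using gumbel_surj[of p] by auto
    with that(3)[of y] p show False by auto
  qed
  show ?thesis using aux[of a b] aux[of b a] assms by force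
qed

text \<open>Identifies the quantile of \<open>gev\<close> at level \<open>gumbel y\<close>: affine
  in \<open>y\<close> or in \<open>exp (\<xi> * y)\<close>. Outside the support \<open>gev\<close>
  is 0 or 1, and there \<open>exp (\<xi> * y) > 0\<close> decides the comparison.\<close>

lemma gumbel_le_gev_iff:
  assumes "\<sigma> > 0"
  shows "gumbel y \<le> gev \<xi> \<mu> \<sigma> x \<longleftrightarrow>
    (if \<xi> = 0 then \<mu> + \<sigma> * y else \<mu> + \<sigma> * (exp (\<xi> * y) - 1) / \<xi>) \<le> x"
proof (cases "\<xi> = 0")
  case True
  then have "gev \<xi> \<mu> \<sigma> x = gumbel ((x - \<mu>) / \<sigma>)"
    by (simp add: gev_def gumbel_def minus_divide_left)
  then show ?thesis using True assms by (simp add: field_simps)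
next
  case False
  define z where "z = 1 + \<xi> * (x - \<mu>) / \<sigma>"
  have R: "\<mu> + \<sigma> * (exp (\<xi> * y) - 1) / \<xi> \<le> x \<longleftrightarrow>
      (if \<xi> > 0 then exp (\<xi> * y) \<le> z else z \<le> exp (\<xi> * y))"
    using False assms unfolding z_def by (auto simp: field_simps)
  show ?thesis
  proof (cases "z > 0")
    case True
    then have "gev \<xi> \<mu> \<sigma> x = gumbel (ln z / \<xi>)"
      using False by (simp add: gev_def gumbel_def powr_def flip: z_def)
    moreover have "y \<le> ln z / \<xi> \<longleftrightarrow> (if \<xi> > 0 then exp (\<xi> * y) \<le> z else z \<le> exp (\<xi> * y))"
    proof -
      have "exp (\<xi> * y) \<le> z \<longleftrightarrow> \<xi> * y \<le> ln z" "z \<le> exp (\<xi> * y) \<longleftrightarrow> ln z \<le> \<xi> * y"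
        using True by (metis exp_le_cancel_iff exp_ln)+
      then show ?thesis using False by (auto simp: field_simps)
    qed
    ultimately show ?thesis using R False by simp
  next
    case nz: False
    then have "gev \<xi> \<mu> \<sigma> x = (if \<xi> > 0 then 0 else 1)"
      using False by (simp add: gev_def flip: z_def)
    moreover have "z \<le> exp (\<xi> * y)" "\<not> exp (\<xi> * y) \<le> z"
      using nz exp_gt_zero[of "\<xi> * y"] by linarith+
    ultimately show ?thesis
      using R False gumbel_bounds[of y] by simp
  qed
qed

lemma gev_in_unit: "gev \<xi> \<mu> \<sigma> x \<in> {0..1}"
  by (simp add: gev_def)

section \<open>Monotone solutions of functional equations\<close>

text \<open>\<open>f\<close> and the linear function with slope \<open>f 1\<close> agree at
  integers. Bracketing \<open>n * x\<close> by consecutive integers bounds their difference there by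
  \<open>f 1\<close>, hence by \<open>f 1 / n\<close> at \<open>x\<close>, for every
  \<open>n\<close>.\<close>

lemma mono_additive_imp_linear:
  fixes f :: "real \<Rightarrow> real"
  assumes "mono f" "Modules.additive f"
  shows "f x = f 1 * x"
proof -
  interpret Modules.additive f by fact
  have nat_mult: "f (real n * x) = real n * f x" for n x
    by (induction n) (simp_all add: zero add distrib_right)
  have int_eq: "f (of_int k) = of_int k * f 1" for k
    using nat_mult[of "nat k" 1] nat_mult[of "nat (- k)" 1] minus[of "of_int (-k)"]
    by (cases "k \<ge> 0") auto
  have nonneg: "0 \<le> f 1" using monoD[OF assms(1), of 0 1] zero by simp
  have bound: "real n * \<bar>f x - f 1 * x\<bar> \<le> f 1" for n
  proof -
    let ?k = "\<lfloor>real n * x\<rfloor>"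
    have "f (of_int ?k) \<le> f (real n * x)" "f (real n * x) \<le> f (of_int (?k + 1))"
      by (rule monoD[OF assms(1)]; linarith)+
    then have 1: "of_int ?k * f 1 \<le> real n * f x" "real n * f x \<le> of_int (?k + 1) * f 1"
      by (simp_all only: int_eq nat_mult)
    have 2: "of_int ?k * f 1 \<le> real n * x * f 1" "real n * x * f 1 \<le> of_int (?k + 1) * f 1"
      by (rule mult_right_mono[OF _ nonneg]; linarith)+
    have "\<bar>real n * f x - real n * x * f 1\<bar> \<le> f 1"
      using 1 2 by (simp add: algebra_simps abs_le_iff)
    then show ?thesis
      by (metis abs_mult abs_of_nat mult.assoc mult.commute right_diff_distrib)
  qed
  show ?thesis
  proof (rule ccontr)
    assume "f x \<noteq> f 1 * x"
    then obtain n where "f 1 < real n * \<bar>f x - f 1 * x\<bar>"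
      using reals_Archimedean3[of "\<bar>f x - f 1 * x\<bar>"] by auto
    with bound[of n] show False by simp
  qed
qed

text \<open>For \<open>V = U - U 0\<close> the hypothesis becomes
  \<open>V (y + h) = V h + A h * V y\<close>, and the left side is symmetric in \<open>y\<close> and
  \<open>h\<close>. Hence either \<open>A\<close> is constantly 1 and \<open>V\<close> is additive,
  or \<open>V\<close> is a multiple of \<open>1 - A\<close> with \<open>A\<close> multiplicative;
  monotonicity makes \<open>V\<close> linear or \<open>A\<close> exponential.\<close>

lemma shift_affine_mono_cases:
  fixes U :: "real \<Rightarrow> real"
  assumes mono: "mono U"
    and nonconst: "a < b" "U a < U b"
    and aff: "\<And>h. \<exists>A>0. \<exists>B. \<forall>y. U (y + h) = A * U y + B"
  obtains \<xi> \<mu> \<sigma> where "\<sigma> > 0"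
    "\<And>y. U y = (if \<xi> = 0 then \<mu> + \<sigma> * y else \<mu> + \<sigma> * (exp (\<xi> * y) - 1) / \<xi>)"
proof -
  obtain A B where A: "\<And>h. A h > 0" and AB: "\<And>h y. U (y + h) = A h * U y + B h"
    using aff by metis
  define V where "V y = U y - U 0" for y
  have V: "V (y + h) = V h + A h * V y" for y h
    using AB[of y h] AB[of 0 h] by (simp add: V_def algebra_simps)
  have V0: "V 0 = 0" by (simp add: V_def)
  have Vmono: "V x \<le> V y" if "x \<le> y" for x y
    using monoD[OF mono that] by (simp add: V_def)
  obtain c where c: "V c \<noteq> 0"
    using nonconst(2) unfolding V_def by (metis diff_eq_diff_eq less_irrefl)
  have sym: "V h * (1 - A y) = V y * (1 - A h)" for h y
    using V[of y h] V[of h y] by (simp add: algebra_simps)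
  have Amult: "A (g + h) = A g * A h" for g h
  proof -
    \<comment> \<open>Both sides are \<open>V (c + g + h)\<close>, expanded with the two ways of
      bracketing.\<close>
    have "V h + A h * (V g + A g * V c) = V h + A h * V g + A (g + h) * V c"
      using V[of "c + g" h] V[of c "g + h"] V[of c g] V[of g h] by (simp add: add.assoc)
    then show ?thesis using c by (simp add: algebra_simps)
  qed
  show ?thesis
  proof (cases "\<forall>y. A y = 1")
    case True
    have "Modules.additive V" using True V by unfold_locales simp
    then have lin: "V y = V 1 * y" for y
      using Vmono by (intro mono_additive_imp_linear monoI)
    have "V a < V b" using nonconst by (simp add: V_def)
    then have "V 1 * a < V 1 * b" using lin by metis
    then have "V 1 > 0" using nonconst(1) by (simp add: mult_less_cancel_left)
    show ?thesis
    proof (rule that)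
      show "V 1 > 0" by fact
      show "U y = (if (0::real) = 0 then U 0 + V 1 * y else U 0 + V 1 * (exp (0 * y) - 1) / 0)" for y
        using lin[of y] by (simp add: V_def)
    qed
  next
    case False
    then obtain y0 where y0: "A y0 \<noteq> 1" by auto
    define k where "k = V y0 / (1 - A y0)"
    have Vk: "V h = k * (1 - A h)" for h
      using sym[of h y0] y0 by (simp add: k_def field_simps)
    have k0: "k \<noteq> 0" using c Vk[of c] by auto
    define \<xi> where "\<xi> = ln (A 1)"
    have add: "Modules.additive (\<lambda>h. ln (A h))"
      using A by unfold_locales (simp add: Amult ln_mult_pos)
    have "ln (A h) = \<xi> * h" for h
    \<comment> \<open>As \<open>V = k * (1 - A)\<close> increases, the sign of \<open>k\<close>
      decides whether \<open>- ln A\<close> or \<open>ln A\<close> is the monotone additive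
      function.\<close>
    proof (cases "k > 0")
      case True
      have "A y \<le> A x" if "x \<le> y" for x y
        using Vmono[OF that] True by (simp add: Vk)
      then have "mono (\<lambda>h. - ln (A h))"
        using A by (simp add: mono_def)
      moreover have "Modules.additive (\<lambda>h. - ln (A h))"
        using add by (simp add: Modules.additive_def)
      ultimately show ?thesis
        using mono_additive_imp_linear[of "\<lambda>h. - ln (A h)" h] by (simp add: \<xi>_def)
    next
      case False
      have "A x \<le> A y" if "x \<le> y" for x y
        using Vmono[OF that] False k0 by (simp add: Vk mult_le_cancel_left)
      then have "mono (\<lambda>h. ln (A h))"
        using A by (simp add: mono_def)
      then show ?thesis
        using mono_additive_imp_linear[OF _ add, of h] by (simp add: \<xi>_def)
    qed
    then have Aexp: "A h = exp (\<xi> * h)" for h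
      using A by (metis exp_ln)
    have \<xi>0: "\<xi> \<noteq> 0" using y0 Aexp by auto
    \<comment> \<open>Chosen so that \<open>\<sigma> * (exp (\<xi> * y) - 1) / \<xi>\<close> equals
      \<open>V y\<close>; monotonicity of \<open>V\<close> gives \<open>k\<close> and
      \<open>\<xi>\<close> opposite signs.\<close>
    define \<sigma> where "\<sigma> = - k * \<xi>"
    have U: "U y = U 0 + \<sigma> * (exp (\<xi> * y) - 1) / \<xi>" for y
    proof -
      have "\<sigma> * (exp (\<xi> * y) - 1) / \<xi> = k * (1 - exp (\<xi> * y))"
        using \<xi>0 by (simp add: \<sigma>_def field_simps)
      then show ?thesis using Vk[of y] by (simp add: V_def Aexp)
    qed
    have "\<sigma> > 0"
    proof -
      have "V 0 \<le> V 1" by (rule Vmono) simp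
      then have "k * (exp \<xi> - 1) \<le> 0" by (simp add: V0 Vk[of 1] Aexp algebra_simps)
      then have "k * \<xi> \<le> 0" using k0
        by (auto simp: mult_le_0_iff)
      then show ?thesis using k0 \<xi>0 by (simp add: \<sigma>_def less_le)
    qed
    moreover have "U y = (if \<xi> = 0 then U 0 + \<sigma> * y else U 0 + \<sigma> * (exp (\<xi> * y) - 1) / \<xi>)" for y
      using U[of y] \<xi>0 by simp
    ultimately show ?thesis by (rule that)
  qed
qed

section \<open>Convergence of types under shifts\<close>

lemma mono_common_continuity_point:
  fixes f g :: "real \<Rightarrow> real"
  assumes "mono f" "mono g" "a < b"
  obtains x where "a < x" "x < b" "isCont f x" "isCont g x"
proof -
  have "countable ({x. \<not> isCont f x} \<union> {x. \<not> isCont g x})"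
    using assms(1,2) by (simp add: mono_ctble_discont)
  then obtain x where "x \<in> {a<..<b}" "x \<notin> {x. \<not> isCont f x} \<union> {x. \<not> isCont g x}"
    using open_minus_countable[of "{x. \<not> isCont f x} \<union> {x. \<not> isCont g x}" "{a<..<b}"] \<open>a < b\<close>
    by (metis greaterThanLessThan_empty_iff not_less open_greaterThanLessThan)
  then show ?thesis using that by auto
qed

text \<open>The values \<open>W (y + s (m n))\<close> are normalized in two ways: with the constants
  of index \<open>m n\<close> the limit is \<open>U y\<close>, with those of index \<open>n\<close>
  it is \<open>U (y + h)\<close>. Two such limits must be related by an increasing affine
  map.\<close>

lemma shifted_limit_affine:
  fixes U W :: "real \<Rightarrow> real" and c d s :: "nat \<Rightarrow> real"
  assumes monoU: "mono U" and monoW: "mono W"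
    and left_cont: "\<And>x y. x < U y \<Longrightarrow> \<exists>y'<y. x < U y'"
    and nonconst: "a < b" "U a < U b"
    and c_pos: "\<And>n. n \<ge> 1 \<Longrightarrow> c n > 0"
    and conv: "\<And>y. isCont U y \<Longrightarrow> (\<lambda>n. (W (y + s n) - d n) / c n) \<longlonglongrightarrow> U y"
    and m: "filterlim m at_top sequentially"
    and shift: "(\<lambda>n. s (m n) - s n) \<longlonglongrightarrow> h"
  shows "\<exists>A>0. \<exists>B. \<forall>y. U (y + h) = A * U y + B"
proof -
  define p where "p y n = (W (y + s (m n)) - d (m n)) / c (m n)" for y n
  define q where "q y n = (W (y + s (m n)) - d n) / c n" for y n
  define U' where "U' y = U (y + h)" for y
  have monoU': "mono U'" using monoU by (simp add: mono_def U'_def)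
  have m1: "\<forall>\<^sub>F n in sequentially. m n \<ge> 1" using m by (simp add: filterlim_at_top)
  have isCont_shift: "isCont U (y + h)" if "isCont U' y" for y
  proof -
    have "isCont (\<lambda>z. U' (z - h)) (y + h)"
      by (rule isCont_o2) (use that in simp_all)
    then show ?thesis by (simp add: U'_def)
  qed
  have p_lim: "p y \<longlonglongrightarrow> U y" if "isCont U y" for y
    unfolding p_def using filterlim_compose[OF conv[OF that] m] by simp
  \<comment> \<open>The shift equals \<open>h\<close> only in the limit. Monotonicity of
    \<open>W\<close> allows \<open>y + s (m n)\<close> to be compared with
    \<open>z + h + s n\<close> for continuity points \<open>z\<close> of \<open>U'\<close> on either
    side of \<open>y\<close>.\<close>
  have q_lim: "q y \<longlonglongrightarrow> U' y" if y: "isCont U' y" for y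
  proof (rule order_tendstoI)
    fix x assume "x < U' y"
    then have "\<forall>\<^sub>F z in at y. x < U' z"
      using order_tendstoD(1)[OF y[unfolded isCont_def]] by blast
    then have "\<forall>\<^sub>F z in at_left y. x < U' z" by (simp add: eventually_at_split)
    then obtain y0 where y0: "y0 < y" "\<And>z. y0 < z \<Longrightarrow> z < y \<Longrightarrow> x < U' z"
      unfolding eventually_at_left_field by blast
    obtain z where z: "y0 < z" "z < y" "isCont U' z"
      using mono_common_continuity_point[OF monoU' monoU' y0(1)] by blast
    have "\<forall>\<^sub>F n in sequentially. x < (W (z + h + s n) - d n) / c n"
      using order_tendstoD(1)[OF conv[OF isCont_shift[OF z(3)]]] y0(2)[OF z(1,2)] by (simp add: U'_def)
    moreover have "\<forall>\<^sub>F n in sequentially. z - y + h < s (m n) - s n"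
      by (rule order_tendstoD(1)[OF shift]) (use z in simp)
    moreover have "\<forall>\<^sub>F n in sequentially. n \<ge> 1" by (rule eventually_ge_at_top)
    ultimately show "\<forall>\<^sub>F n in sequentially. x < q y n"
    proof eventually_elim
      case (elim n)
      have "W (z + h + s n) \<le> W (y + s (m n))" using elim by (intro monoD[OF monoW]) simp
      then have "(W (z + h + s n) - d n) / c n \<le> q y n"
        unfolding q_def using c_pos[of n] elim by (intro divide_right_mono) auto
      then show ?case using elim by simp
    qed
  next
    fix x assume "U' y < x"
    then have "\<forall>\<^sub>F z in at y. U' z < x"
      using order_tendstoD(2)[OF y[unfolded isCont_def]] by blast
    then have "\<forall>\<^sub>F z in at_right y. U' z < x" by (simp add: eventually_at_split)
    then obtain y0 where y0: "y < y0" "\<And>z. y < z \<Longrightarrow> z < y0 \<Longrightarrow> U' z < x"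
      unfolding eventually_at_right_field by blast
    obtain z where z: "y < z" "z < y0" "isCont U' z"
      using mono_common_continuity_point[OF monoU' monoU' y0(1)] by blast
    have "\<forall>\<^sub>F n in sequentially. (W (z + h + s n) - d n) / c n < x"
      using order_tendstoD(2)[OF conv[OF isCont_shift[OF z(3)]]] y0(2)[OF z(1,2)] by (simp add: U'_def)
    moreover have "\<forall>\<^sub>F n in sequentially. s (m n) - s n < z - y + h"
      by (rule order_tendstoD(2)[OF shift]) (use z in simp)
    moreover have "\<forall>\<^sub>F n in sequentially. n \<ge> 1" by (rule eventually_ge_at_top)
    ultimately show "\<forall>\<^sub>F n in sequentially. q y n < x"
    proof eventually_elim
      case (elim n)
      have "W (y + s (m n)) \<le> W (z + h + s n)" using elim by (intro monoD[OF monoW]) simp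
      then have "q y n \<le> (W (z + h + s n) - d n) / c n"
        unfolding q_def using c_pos[of n] elim by (intro divide_right_mono) auto
      then show ?case using elim by simp
    qed
  qed
  \<comment> \<open>The points \<open>y1\<close> and \<open>y2\<close> lie so far out that both
    \<open>U\<close> and its shift \<open>U'\<close> increase strictly from one to the
    other.\<close>
  have "min a (a - h) - 1 < min a (a - h)" by linarith
  then obtain y1 where y1: "y1 < min a (a - h)" "isCont U y1" "isCont U' y1"
    using mono_common_continuity_point[OF monoU monoU'] by blast
  have "max b (b - h) < max b (b - h) + 1" by linarith
  then obtain y2 where y2: "max b (b - h) < y2" "isCont U y2" "isCont U' y2"
    using mono_common_continuity_point[OF monoU monoU'] by blast
  have "U y1 \<le> U a" "U b \<le> U y2" "U' y1 \<le> U a" "U b \<le> U' y2"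
    unfolding U'_def using y1 y2 by (auto intro!: monoD[OF monoU])
  then have less: "U y1 < U y2" "U' y1 < U' y2" using nonconst by linarith+
  \<comment> \<open>The affine map with coefficients \<open>A\<close> and \<open>B\<close> is the
    one that sends \<open>U y1\<close> to \<open>U' y1\<close> and \<open>U y2\<close> to
    \<open>U' y2\<close>.\<close>
  define A where "A = (U' y2 - U' y1) / (U y2 - U y1)"
  define B where "B = U' y1 - A * U y1"
  have "A > 0" using less by (simp add: A_def)
  have q_eq: "\<forall>\<^sub>F n in sequentially. q y n = c (m n) / c n * p y n + (d (m n) - d n) / c n" for y
    using m1 eventually_ge_at_top[of 1]
  proof eventually_elim
    case (elim n)
    then have "c n > 0" "c (m n) > 0" using c_pos by auto
    then show ?case by (simp add: p_def q_def field_simps)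
  qed
  have A_lim: "(\<lambda>n. c (m n) / c n) \<longlonglongrightarrow> A"
  proof (rule Lim_transform_eventually)
    show "(\<lambda>n. (q y2 n - q y1 n) / (p y2 n - p y1 n)) \<longlonglongrightarrow> A"
      unfolding A_def using less y1 y2 by (intro tendsto_intros p_lim q_lim) auto
    have "\<forall>\<^sub>F n in sequentially. 0 < p y2 n - p y1 n"
      by (rule order_tendstoD(1)[OF tendsto_diff[OF p_lim[OF y2(2)] p_lim[OF y1(2)]]]) (use less in simp)
    then show "\<forall>\<^sub>F n in sequentially. (q y2 n - q y1 n) / (p y2 n - p y1 n) = c (m n) / c n"
      using q_eq[of y1] q_eq[of y2]
    proof eventually_elim
      case (elim n)
      have "q y2 n - q y1 n = c (m n) / c n * (p y2 n - p y1 n)"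
        unfolding elim(2,3) by (simp add: algebra_simps)
      then show ?case using elim(1) by simp
    qed
  qed
  have B_lim: "(\<lambda>n. (d (m n) - d n) / c n) \<longlonglongrightarrow> B"
  proof (rule Lim_transform_eventually)
    show "(\<lambda>n. q y1 n - c (m n) / c n * p y1 n) \<longlonglongrightarrow> B"
      unfolding B_def using y1 by (intro tendsto_intros p_lim q_lim A_lim)
    show "\<forall>\<^sub>F n in sequentially. q y1 n - c (m n) / c n * p y1 n = (d (m n) - d n) / c n"
      using q_eq[of y1] by eventually_elim simp
  qed
  have common: "U' y = A * U y + B" if "isCont U y" "isCont U' y" for y
  proof (rule LIMSEQ_unique)
    show "q y \<longlonglongrightarrow> U' y" by (rule q_lim) fact
    show "q y \<longlonglongrightarrow> A * U y + B"
    proof (rule Lim_transform_eventually)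
      show "(\<lambda>n. c (m n) / c n * p y n + (d (m n) - d n) / c n) \<longlonglongrightarrow> A * U y + B"
        using that by (intro tendsto_intros A_lim B_lim p_lim)
      show "\<forall>\<^sub>F n in sequentially. c (m n) / c n * p y n + (d (m n) - d n) / c n = q y n"
        using q_eq[of y] by eventually_elim simp
    qed
  qed
  have le: "A * U y + B \<le> A * U z + B" if "y \<le> z" for y z
    using monoD[OF monoU that] \<open>A > 0\<close> by simp
  \<comment> \<open>So far the identity holds at common continuity points, which are dense. Since
    \<open>U\<close> is left-continuous by \<open>left_cont\<close>, a failure at \<open>y\<close>
    would persist at such a point slightly to the left.\<close>
  have "U' y = A * U y + B" for y
  proof (rule antisym)
    show "U' y \<le> A * U y + B"
    proof (rule ccontr)
      assume "\<not> U' y \<le> A * U y + B"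
      then obtain w where w: "w < y + h" "A * U y + B < U w"
        using left_cont[of "A * U y + B" "y + h"] by (auto simp: U'_def)
      obtain z where z: "w - h < z" "z < y" "isCont U z" "isCont U' z"
        using mono_common_continuity_point[OF monoU monoU', of "w - h" y] w by (smt (verit))
      have "U w \<le> U' z" unfolding U'_def using z by (intro monoD[OF monoU]) simp
      then show False using common[OF z(3,4)] le[of z y] z w by simp
    qed
    show "A * U y + B \<le> U' y"
    proof (rule ccontr)
      assume "\<not> A * U y + B \<le> U' y"
      then have "(U' y - B) / A < U y" using \<open>A > 0\<close> by (simp add: field_simps)
      then obtain w where w: "w < y" "(U' y - B) / A < U w" using left_cont by blast
      obtain z where z: "w < z" "z < y" "isCont U z" "isCont U' z"
        using mono_common_continuity_point[OF monoU monoU' w(1)] by blast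
      have "U' y < A * U w + B" using w \<open>A > 0\<close> by (simp add: field_simps)
      also have "\<dots> \<le> U' z" using le[of w z] common[OF z(3,4)] z by simp
      also have "\<dots> \<le> U' y" using monoD[OF monoU', of z y] z by simp
      finally show False by simp
    qed
  qed
  then show ?thesis using \<open>A > 0\<close> unfolding U'_def by blast
qed

section \<open>Maxima, copula diagonals and the limit law\<close>

text \<open>A maximum stays below a level iff all the variables do, so the copula is evaluated at
  equal arguments. For \<open>n \<ge> 1\<close> the maximum is over a nonempty set.\<close>

lemma cdf_partial_max_normalized:
  assumes M: "prob_space M" and n: "n \<ge> 1" and c: "c > 0"
    and meas: "\<And>i. i \<ge> 1 \<Longrightarrow> X i \<in> borel_measurable M"
    and cop: "copula_of M X F n C"
  shows "cdf (distr M borel (\<lambda>\<omega>. (partial_max X n \<omega> - d) / c)) x = diagonal n C (F (c * x + d))"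
proof -
  have [measurable]: "partial_max X n \<in> borel_measurable M"
    unfolding partial_max_def[abs_def] by (rule borel_measurable_Max) (auto intro: meas)
  have le_iff: "(partial_max X n \<omega> - d) / c \<le> x \<longleftrightarrow> (\<forall>i\<in>{1..n}. X i \<omega> \<le> c * x + d)" for \<omega>
  proof -
    have "(partial_max X n \<omega> - d) / c \<le> x \<longleftrightarrow> partial_max X n \<omega> \<le> c * x + d"
      using c by (auto simp: field_simps)
    also have "\<dots> \<longleftrightarrow> (\<forall>i\<in>{1..n}. X i \<omega> \<le> c * x + d)"
      unfolding partial_max_def using n by (subst Max_le_iff) auto
    finally show ?thesis .
  qed
  have "cdf (distr M borel (\<lambda>\<omega>. (partial_max X n \<omega> - d) / c)) x =
      measure M ((\<lambda>\<omega>. (partial_max X n \<omega> - d) / c) -` {..x} \<inter> space M)"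
    unfolding cdf_def by (rule measure_distr) measurable
  also have "(\<lambda>\<omega>. (partial_max X n \<omega> - d) / c) -` {..x} \<inter> space M =
      {\<omega> \<in> space M. \<forall>i\<in>{1..n}. X i \<omega> \<le> c * x + d}"
    using le_iff by auto
  also have "measure M \<dots> = diagonal n C (F (c * x + d))"
    using cop unfolding copula_of_def diagonal_def by (auto dest: spec[of _ "\<lambda>_. c * x + d"])
  finally show ?thesis .
qed

theorem theorem2p10:
  fixes M :: "'a measure"
    and X :: "nat \<Rightarrow> 'a \<Rightarrow> real"
    and F G D lam :: "real \<Rightarrow> real"
    and C :: "nat \<Rightarrow> (nat \<Rightarrow> real) \<Rightarrow> real"
    and r c d :: "nat \<Rightarrow> real"
  assumes "prob_space M"
    and "\<And>n. n \<ge> 1 \<Longrightarrow> X n \<in> borel_measurable M"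
    and "\<And>n. n \<ge> 1 \<Longrightarrow> cdf (distr M borel (X n)) = F"
    and "continuous_on UNIV F"
    and "\<And>n. n \<ge> 1 \<Longrightarrow> copula_of M X F n (C n)"
    and "\<And>n. n \<ge> 1 \<Longrightarrow> strict_mono_on {0..1} (diagonal n (C n))"
    and "\<And>n. n \<ge> 1 \<Longrightarrow> r n > 0"
    and "bij_betw lam {0<..} {0<..}"
    and "filterlim r at_top sequentially"
    and "\<And>t. t > 0 \<Longrightarrow> (\<lambda>n. r (nat \<lceil>t * real n\<rceil>) / r n) \<longlonglongrightarrow> lam t"
    and "\<And>u. u \<in> {0..1} \<Longrightarrow> (\<lambda>n. diagonal_power_distortion C r n u) \<longlonglongrightarrow> D u"
    and "continuous_on {0..1} D"
    and "strict_mono_on {0..1} D"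
    and "bij_betw D {0..1} {0..1}"
    and "\<And>n. n \<ge> 1 \<Longrightarrow> c n > 0"
    and "distribution_function G"
    and "nondegenerate G"
    and "weak_conv (\<lambda>n. cdf (distr M borel (\<lambda>\<omega>. (partial_max X n \<omega> - d n) / c n))) G"
  shows "\<exists>\<xi> \<mu> \<sigma>. \<sigma> > 0 \<and> G = D \<circ> gev \<xi> \<mu> \<sigma>"
proof -
  interpret prob_space M by fact
  note X_meas = assms(2) and copula = assms(5) and diag_mono = assms(6) and r_pos = assms(7)
    and c_pos = assms(15)
  have F_cdf: "F = cdf (distr M borel (X 1))" using assms(3)[of 1] by simp
  interpret F: cdf_distribution "distr M borel (X 1)"
    using X_meas[of 1] by (simp add: cdf_distribution_def)
  obtain N where "real_distribution N" and G_cdf: "G = cdf N"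
    using assms(16) by (auto simp: distribution_function_def)
  interpret N: cdf_distribution N using \<open>real_distribution N\<close> by (simp add: cdf_distribution_def)

  \<comment> \<open>The levels lie strictly between 0 and 1, so the infima are genuine quantiles;
    the argument uses them only through the equivalences \<open>W_le_iff\<close> and
    \<open>U_le_iff\<close>.\<close>
  define W where "W y = Inf {x. gumbel y \<le> F x}" for y
  define U where "U y = Inf {x. D (gumbel y) \<le> G x}" for y
  have W_le_iff: "W y \<le> x \<longleftrightarrow> gumbel y \<le> F x" for x y
    using F.pseudoinverse[of "gumbel y" x] by (simp add: W_def F_cdf gumbel_bounds)
  have D_le_iff: "D u \<le> D v \<longleftrightarrow> u \<le> v" if "u \<in> {0..1}" "v \<in> {0..1}" for u v
    using strict_mono_on_less_eq[OF assms(13) that] .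
  have gumbel_unit: "gumbel y \<in> {0..1}" for y
    using gumbel_bounds[of y] by simp
  have D_unit: "D u \<in> {0..1}" if "u \<in> {0..1}" for u
    using assms(14) that by (auto simp: bij_betw_def)
  have D_gumbel: "0 < D (gumbel y)" "D (gumbel y) < 1" for y
    using D_le_iff[of "gumbel y" 0] D_le_iff[of 1 "gumbel y"] D_unit[of 0] D_unit[of 1]
      gumbel_bounds[of y] by force+
  have U_le_iff: "U y \<le> x \<longleftrightarrow> D (gumbel y) \<le> G x" for x y
    using N.pseudoinverse[of "D (gumbel y)" x] D_gumbel by (simp add: U_def G_cdf)
  have G_unit: "G x \<in> {0..1}" for x
    by (simp add: G_cdf N.cdf_nonneg N.cdf_bounded_prob)
  have F_unit: "F x \<in> {0..1}" for x
    using F.cdf_nonneg[of x] F.cdf_bounded_prob[of x] by (simp add: F_cdf)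
  have monoG: "mono G" by (simp add: G_cdf N.mono)
  \<comment> \<open>\<open>E\<close> is \<open>G\<close> followed by the inverse of
    \<open>D\<close>; it remains to show that \<open>E\<close> is a generalized extreme value
    distribution function.\<close>
  obtain E where E: "\<And>x. E x \<in> {0..1}" "\<And>x. G x = D (E x)"
  proof -
    have "\<forall>x. \<exists>v. v \<in> {0..1} \<and> G x = D v"
    proof
      fix x
      have "G x \<in> D ` {0..1}" using assms(14) G_unit[of x] by (simp add: bij_betw_def)
      then show "\<exists>v. v \<in> {0..1} \<and> G x = D v" by blast
    qed
    then show thesis using that by (auto dest!: choice)
  qed
  have U_le_iff': "U y \<le> x \<longleftrightarrow> gumbel y \<le> E x" for x y
    by (simp add: U_le_iff E(2) D_le_iff[OF gumbel_unit E(1)])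

  have monoW: "mono W"
  proof (rule monoI)
    fix y z :: real assume "y \<le> z"
    then have "gumbel y \<le> gumbel z" by simp
    also have "gumbel z \<le> F (W z)" using W_le_iff[of z "W z"] by simp
    finally show "W y \<le> W z" by (simp add: W_le_iff)
  qed
  have monoU: "mono U"
  proof (rule monoI)
    fix y z :: real assume "y \<le> z"
    then have "gumbel y \<le> gumbel z" by simp
    also have "gumbel z \<le> E (U z)" using U_le_iff'[of z "U z"] by simp
    finally show "U y \<le> U z" by (simp add: U_le_iff')
  qed
  have left_cont: "\<exists>y'<y. x < U y'" if "x < U y" for x y
  proof -
    have "E x < gumbel y" using that U_le_iff'[of y x] by simp
    then obtain p where p: "E x < p" "p < gumbel y" using dense by blast
    have "0 < p" "p < 1" using p E(1)[of x] gumbel_bounds[of y] by auto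
    then obtain y' where y': "p = gumbel y'" by (rule gumbel_surj)
    have "y' < y" using p y' gumbel_le_iff[of y y'] by linarith
    moreover have "x < U y'" using p y' U_le_iff'[of y' x] by simp
    ultimately show ?thesis by blast
  qed

  \<comment> \<open>If all quantiles coincided, \<open>E\<close> would be the indicator of a
    half-line, and so would \<open>G\<close>, because \<open>D\<close> fixes 0 and 1.\<close>
  have nonconst: "\<exists>a b. a < b \<and> U a < U b"
  proof (rule ccontr)
    assume no: "\<not> ?thesis"
    have const: "U y = U 0" for y
    proof (cases y "0 :: real" rule: linorder_cases)
      case less
      then show ?thesis using no monoD[OF monoU, of y 0] by force
    next
      case greater
      then show ?thesis using no monoD[OF monoU, of 0 y] by force
    qed simp
    have "E x = indicator {U 0..} x" for x
    proof (rule eq_if_same_gumbel_below)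
      show "gumbel y \<le> E x \<longleftrightarrow> gumbel y \<le> indicator {U 0..} x" for y
        using U_le_iff'[of y x] const[of y] gumbel_bounds[of y] by (auto simp: indicator_def)
    qed (use E in \<open>auto simp: indicator_def\<close>)
    moreover have "D 0 = 0" "D 1 = 1"
    proof -
      have "0 \<in> D ` {0..1}" "1 \<in> D ` {0..1}" using assms(14) by (simp_all add: bij_betw_def)
      then obtain u v where "u \<in> {0..1}" "0 = D u" "v \<in> {0..1}" "1 = D v" by blast
      then show "D 0 = 0" "D 1 = 1"
        using D_le_iff[of 0 u] D_le_iff[of v 1] D_unit[of 0] D_unit[of 1] by auto
    qed
    ultimately have "G = indicator {U 0..}"
      using E(2) by (auto simp: fun_eq_iff indicator_def)
    then show False using assms(17) by (auto simp: nondegenerate_def)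
  qed
  then obtain a b where ab: "a < b" "U a < U b" by blast

  \<comment> \<open>The strictly increasing diagonal is applied to both sides of
    \<open>gumbel (y + ln (r n)) \<le> F (c n * x + d n)\<close>; this relates quantiles to the two
    functions whose limits are known.\<close>
  have compare: "W (y + ln (r n)) \<le> c n * x + d n \<longleftrightarrow>
      diagonal_power_distortion C r n (gumbel y) \<le>
        cdf (distr M borel (\<lambda>\<omega>. (partial_max X n \<omega> - d n) / c n)) x" if n: "n \<ge> 1" for n x y
  proof -
    have "diagonal_power_distortion C r n (gumbel y) = diagonal n (C n) (gumbel (y + ln (r n)))"
      by (simp only: diagonal_power_distortion_def gumbel_powr_inverse[OF r_pos[OF n]])
    moreover have "cdf (distr M borel (\<lambda>\<omega>. (partial_max X n \<omega> - d n) / c n)) x =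
        diagonal n (C n) (F (c n * x + d n))"
      by (rule cdf_partial_max_normalized[OF \<open>prob_space M\<close> n c_pos[OF n] X_meas copula[OF n]])
    moreover have "diagonal n (C n) u \<le> diagonal n (C n) v \<longleftrightarrow> u \<le> v"
      if "u \<in> {0..1}" "v \<in> {0..1}" for u v
      using strict_mono_on_less_eq[OF diag_mono[OF n] that] .
    ultimately show ?thesis using gumbel_unit F_unit by (simp only: W_le_iff)
  qed
  have G_lim: "(\<lambda>n. cdf (distr M borel (\<lambda>\<omega>. (partial_max X n \<omega> - d n) / c n)) x) \<longlonglongrightarrow> G x"
    if "isCont G x" for x
    using assms(18) that by (simp add: weak_conv_def)
  have D_lim: "(\<lambda>n. diagonal_power_distortion C r n (gumbel y)) \<longlonglongrightarrow> D (gumbel y)" for y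
    by (rule assms(11)) (rule gumbel_unit)

  have conv: "(\<lambda>n. (W (y + ln (r n)) - d n) / c n) \<longlonglongrightarrow> U y" if y: "isCont U y" for y
  proof (rule order_tendstoI)
    fix x assume "x < U y"
    then obtain z where z: "x < z" "z < U y" "isCont G z"
      using mono_common_continuity_point[OF monoG monoG] by blast
    \<comment> \<open>A strict inequality between the limits persists for large \<open>n\<close>,
      where \<open>compare\<close> turns it into a bound on the quantiles.\<close>
    then have "G z < D (gumbel y)" using U_le_iff[of y z] by simp
    then have "\<forall>\<^sub>F n in sequentially. 0 < diagonal_power_distortion C r n (gumbel y) -
        cdf (distr M borel (\<lambda>\<omega>. (partial_max X n \<omega> - d n) / c n)) z"
      by (intro order_tendstoD(1)[OF tendsto_diff[OF D_lim G_lim[OF z(3)]]]) simp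
    then show "\<forall>\<^sub>F n in sequentially. x < (W (y + ln (r n)) - d n) / c n"
      using eventually_ge_at_top[of 1]
    proof eventually_elim
      case (elim n)
      then have "c n * z + d n < W (y + ln (r n))" using compare[of n y z] by simp
      then have "z < (W (y + ln (r n)) - d n) / c n"
        using c_pos[of n] elim(2) by (simp add: field_simps)
      with z show ?case by simp
    qed
  next
    fix x assume "U y < x"
    then have "\<forall>\<^sub>F w in at y. U w < x"
      using order_tendstoD(2)[OF y[unfolded isCont_def]] by blast
    then have "\<forall>\<^sub>F w in at_right y. U w < x" by (simp add: eventually_at_split)
    then obtain y0 where y0: "y < y0" "\<And>w. y < w \<Longrightarrow> w < y0 \<Longrightarrow> U w < x"
      unfolding eventually_at_right_field by blast
    \<comment> \<open>Taking \<open>z > U y\<close> would give only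
      \<open>D (gumbel y) \<le> G z\<close>. Continuity of \<open>U\<close> at \<open>y\<close>
      leaves room for \<open>w > y\<close> with \<open>U w < x\<close>, which makes the inequality
      strict.\<close>
    obtain w where w: "y < w" "w < y0" using dense[OF y0(1)] by blast
    obtain z where z: "U w < z" "z < x" "isCont G z"
      using mono_common_continuity_point[OF monoG monoG y0(2)[OF w]] by blast
    have "D (gumbel y) < D (gumbel w)"
      using D_le_iff[OF gumbel_unit gumbel_unit, of w y] w(1) by simp
    also have "\<dots> \<le> G z" using U_le_iff[of w z] z by simp
    finally have "\<forall>\<^sub>F n in sequentially.
        0 < cdf (distr M borel (\<lambda>\<omega>. (partial_max X n \<omega> - d n) / c n)) z -
          diagonal_power_distortion C r n (gumbel y)"
      by (intro order_tendstoD(1)[OF tendsto_diff[OF G_lim[OF z(3)] D_lim]]) simp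
    then show "\<forall>\<^sub>F n in sequentially. (W (y + ln (r n)) - d n) / c n < x"
      using eventually_ge_at_top[of 1]
    proof eventually_elim
      case (elim n)
      then have "W (y + ln (r n)) \<le> c n * z + d n" using compare[of n y z] by simp
      then have "(W (y + ln (r n)) - d n) / c n \<le> z"
        using c_pos[of n] elim(2) by (simp add: field_simps)
      with z show ?case by simp
    qed
  qed

  have affine: "\<exists>A>0. \<exists>B. \<forall>y. U (y + h) = A * U y + B" for h
  proof -
    \<comment> \<open>Surjectivity of \<open>lam\<close> realizes every real shift \<open>h\<close>
      as \<open>ln (lam t)\<close>, the limit of \<open>ln (r (m n)) - ln (r n)\<close> along the
      indices \<open>m n\<close>.\<close>
    have "exp h \<in> lam ` {0<..}" using assms(8) by (simp add: bij_betw_def)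
    then obtain t where t: "t > 0" "lam t = exp h" by auto
    define m where "m n = nat \<lceil>t * real n\<rceil>" for n
    have m_ge: "t * real n \<le> real (m n)" for n
      unfolding m_def by (rule real_nat_ceiling_ge)
    have "filterlim (\<lambda>n. t * real n) at_top sequentially"
      using t(1) by (intro filterlim_tendsto_pos_mult_at_top[OF tendsto_const] filterlim_real_sequentially)
    then have "filterlim (\<lambda>n. real (m n)) at_top sequentially"
      by (rule filterlim_at_top_mono) (simp add: m_ge)
    then have m_lim: "filterlim m at_top sequentially"
      by (simp add: filterlim_sequentially_iff_filterlim_real)
    have "(\<lambda>n. ln (r (m n) / r n)) \<longlonglongrightarrow> ln (exp h)"
      using assms(10)[OF t(1)] by (intro tendsto_ln) (simp_all add: m_def t)
    then have "(\<lambda>n. ln (r (m n) / r n)) \<longlonglongrightarrow> h" by simp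
    moreover have "\<forall>\<^sub>F n in sequentially. ln (r (m n) / r n) = ln (r (m n)) - ln (r n)"
      using eventually_ge_at_top[of 1]
    proof eventually_elim
      case (elim n)
      then have "0 < t * real n" using t by simp
      \<comment> \<open>Positivity of \<open>r\<close> is available only from index 1 on.\<close>
      then have "m n \<ge> 1" using m_ge[of n] by linarith
      then show ?case using r_pos[of n] r_pos[of "m n"] elim by (simp add: ln_div)
    qed
    ultimately have "(\<lambda>n. ln (r (m n)) - ln (r n)) \<longlonglongrightarrow> h"
      by (rule Lim_transform_eventually)
    with monoU monoW left_cont ab c_pos conv m_lim show ?thesis
      by (rule shifted_limit_affine[where W = W and s = "\<lambda>n. ln (r n)"])
  qed

  obtain \<xi> \<mu> \<sigma> where \<sigma>: "\<sigma> > 0"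
    and U: "\<And>y. U y = (if \<xi> = 0 then \<mu> + \<sigma> * y else \<mu> + \<sigma> * (exp (\<xi> * y) - 1) / \<xi>)"
    using monoU ab affine by (rule shift_affine_mono_cases) (rule that)
  \<comment> \<open>Both functions have the quantile \<open>U y\<close> at each level
    \<open>gumbel y\<close>.\<close>
  have "E x = gev \<xi> \<mu> \<sigma> x" for x
  proof (rule eq_if_same_gumbel_below)
    show "gumbel y \<le> E x \<longleftrightarrow> gumbel y \<le> gev \<xi> \<mu> \<sigma> x" for y
      unfolding gumbel_le_gev_iff[OF \<sigma>] U_le_iff'[symmetric] U ..
  qed (rule E(1) gev_in_unit)+
  then have "G = D \<circ> gev \<xi> \<mu> \<sigma>"
    by (simp add: fun_eq_iff E(2))
  with \<sigma> show ?thesis by blast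
qed

end
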